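(* Let $e=2$ and let $\Lambda=a_0\Lambda_0+a_1\Lambda_1$ be a dominant integral weight of $A^{(1)}_1$ with $r=a_0+a_1\geq 1$. Set $b_0=\lfloor a_0/2\rfloor$. Write each integer $m$ in the form $m=qr+u$ with $q\in\mathbb Z$ and $-b_0\le u\le r-b_0-1$. For $m\in\mathbb Z$ set \[ \eta_m=(a_0+2m)\Lambda_0+(a_1-2m)\Lambda_1-t(m)\delta, \] where \[ t(m)=\max(-u,0,u-a_1)-q(a_1-2u)+q^2r . \] Then 1. $\operatorname{hub}(\eta_m)=[a_0+2m,\;a_1-2m]$; 2. $\max(\Lambda)=\{\eta_m\mid m\in\mathbb Z\}$; 3. $\operatorname{def}(\eta_m)=\max\big(-u(a_0+u),\;u(a_1-u),\;(u-a_1)(r-u)\big)$; 4. $\operatorname{cont}(\eta_m)=(s(m),\,s(m)+m)$; 5. $\deg(\eta_m)=2s(m)+m$.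
   Context: Let $\mathfrak g=A^{(1)}_1$ be the affine Lie algebra with fundamental weights $\Lambda_0,\Lambda_1$, null root $\delta=\alpha_0+\alpha_1$ and simple roots $\alpha_0=2\Lambda_0-2\Lambda_1+\delta$, $\alpha_1=-2\Lambda_0+2\Lambda_1$. Weights are written in the basis $\Lambda_0,\Lambda_1,\delta$ of the weight space. Let $(\cdot\mid\cdot)$ be the standard symmetric form, so $(\lambda\mid\alpha_i)=\langle\lambda,\alpha_i^\vee\rangle$, $(\alpha_i\mid\alpha_i)=2$, $(\alpha_0\mid\alpha_1)=-2$. Let $V(\Lambda)$ be the irreducible highest weight module with highest weight $\Lambda$, $P(\Lambda)$ its set of weights, and $\max(\Lambda)=\{\lambda\in P(\Lambda)\mid\lambda+\delta\notin P(\Lambda)\}$. Every $\lambda\in P(\Lambda)$ has the form $\Lambda-\alpha$ with $\alpha=c_0\alpha_0+c_1\alpha_1$, $c_0,c_1\in\mathbb Z_{\ge0}$. Its content is $\operatorname{cont}(\lambda)=(c_0,c_1)$; its degree is $\deg(\lambda)=c_0+c_1$; its hub is $\operatorname{hub}(\lambda)=[\theta_0,\theta_1]$ with $\theta_i=\langle\lambda,\alpha_i^\vee\rangle$; its defect is $\operatorname{def}(\lambda)=\tfrac12\big((\Lambda\mid\Lambda)-(\lambda\mid\lambda)\big)=(\Lambda\mid\alpha)-\tfrac12(\alpha\mid\alpha)$. For $m\in\mathbb Z$, $s(m)$ denotes the unique integer such that $\Lambda-m\alpha_1-s(m)\delta\in\max(\Lambda)$. *)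

theory Defs
  imports "HOL-Analysis.Analysis" "HOL-Library.Poly_Mapping"
begin

section \<open>The affine Lie algebra of type A_1^(1)\<close>

text \<open>
  The algebra is taken in its loop realization: the underlying space is
  sl_2(C[t,t^-1]) + C K + C d, where K is central and d acts as t d/dt.
  A Laurent polynomial is a finitely supported function on the integers (its convolution product
  is the multiplication of the ring), and a triple (X, k, b) stands for X + k K + b d.
\<close>

type_synonym laurent = "int \<Rightarrow>\<^sub>0 complex"
type_synonym affine = "(laurent ^ 2 ^ 2) \<times> complex \<times> complex"

definition affine_carrier :: "affine set" where
  "affine_carrier = {(X, k, b). trace X = 0}"

definition loop_scale :: "complex \<Rightarrow> laurent ^ 2 ^ 2 \<Rightarrow> laurent ^ 2 ^ 2" where
  "loop_scale c X = (\<chi> i j. Poly_Mapping.single 0 c * X $ i $ j)"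

definition loop_deriv :: "laurent ^ 2 ^ 2 \<Rightarrow> laurent ^ 2 ^ 2" where
  "loop_deriv X = (\<chi> i j. Poly_Mapping.mapp (\<lambda>n c. of_int n * c) (X $ i $ j))"

fun affine_scale :: "complex \<Rightarrow> affine \<Rightarrow> affine" where
  "affine_scale c (X, k, b) = (loop_scale c X, c * k, c * b)"

text \<open>
  The coefficient of K is the residue of tr(X'(t) Y(t)); on homogeneous elements
  x t^m and y t^n it is m tr(x y) if m + n = 0, and 0 otherwise.
\<close>

fun affine_bracket :: "affine \<Rightarrow> affine \<Rightarrow> affine" where
  "affine_bracket (X, k, b) (Y, k', b') =
     (X ** Y - Y ** X + loop_scale b (loop_deriv Y) - loop_scale b' (loop_deriv X),
      Poly_Mapping.lookup (trace (loop_deriv X ** Y)) 0,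
      0)"

text \<open>The positive Chevalley generators: \<open>e1 = E_12\<close> and \<open>e0 = t E_21\<close>.\<close>

definition gen_e0 :: affine where
  "gen_e0 = (vector [vector [0, 0], vector [Poly_Mapping.single 1 1, 0]], 0, 0)"

definition gen_e1 :: affine where
  "gen_e1 = (vector [vector [0, 1], vector [0, 0]], 0, 0)"

inductive_set n_plus :: "affine set" where
  e0: "gen_e0 \<in> n_plus"
| e1: "gen_e1 \<in> n_plus"
| add: "x \<in> n_plus \<Longrightarrow> y \<in> n_plus \<Longrightarrow> x + y \<in> n_plus"
| scale: "x \<in> n_plus \<Longrightarrow> affine_scale c x \<in> n_plus"
| bracket: "x \<in> n_plus \<Longrightarrow> y \<in> n_plus \<Longrightarrow> affine_bracket x y \<in> n_plus"

text \<open>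
  Elements of the Cartan subalgebra are given by their coordinates in the basis
  \<open>\<alpha>\<^sub>0\<^sup>\<or> = K - H\<close>, \<open>\<alpha>\<^sub>1\<^sup>\<or> = H\<close>, \<open>d\<close>, where \<open>H = diag(1,-1)\<close>.
  Weights are given by their coordinates in the dual basis
  \<open>\<Lambda>\<^sub>0, \<Lambda>\<^sub>1, \<delta>\<close>.
\<close>

type_synonym cartan = "complex ^ 3"
type_synonym weight = "complex ^ 3"

definition cartan_embed :: "cartan \<Rightarrow> affine" where
  "cartan_embed h =
     (vector [vector [Poly_Mapping.single 0 (h $ 2 - h $ 1), 0],
              vector [0, Poly_Mapping.single 0 (h $ 1 - h $ 2)]],
      h $ 1, h $ 3)"

definition coroot0 :: cartan where "coroot0 = axis 1 1"
definition coroot1 :: cartan where "coroot1 = axis 2 1"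

definition pairing :: "weight \<Rightarrow> cartan \<Rightarrow> complex" where
  "pairing \<mu> h = (\<Sum>i\<in>UNIV. \<mu> $ i * h $ i)"

definition Lambda0 :: weight where "Lambda0 = axis 1 1"
definition Lambda1 :: weight where "Lambda1 = axis 2 1"
definition null_root :: weight where "null_root = axis 3 1"

definition root0 :: weight where
  "root0 = 2 *s Lambda0 - 2 *s Lambda1 + null_root"

definition root1 :: weight where
  "root1 = - 2 *s Lambda0 + 2 *s Lambda1"

text \<open>
  The standard form, normalized by \<open>(\<Lambda>\<^sub>0 | \<Lambda>\<^sub>0) = 0\<close>. The remaining values
  are forced by \<open>(\<mu> | \<alpha>\<^sub>i) = \<langle>\<mu>, \<alpha>\<^sub>i\<^sup>\<or>\<rangle>\<close>.
\<close>

definition form :: "weight \<Rightarrow> weight \<Rightarrow> complex" where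
  "form \<mu> \<nu> = (\<mu> $ 1 + \<mu> $ 2) * \<nu> $ 3 + \<mu> $ 3 * (\<nu> $ 1 + \<nu> $ 2) + \<mu> $ 2 * \<nu> $ 2 / 2"

lemma form_root0: "form \<mu> root0 = pairing \<mu> coroot0"
  and form_root1: "form \<mu> root1 = pairing \<mu> coroot1"
  by (simp_all add: form_def pairing_def root0_def root1_def coroot0_def coroot1_def Lambda0_def
      Lambda1_def null_root_def axis_def sum_3)

section \<open>Irreducible highest weight modules\<close>

locale affine_module = vector_space smul
  for smul :: "complex \<Rightarrow> 'v::ab_group_add \<Rightarrow> 'v" +
  fixes act :: "affine \<Rightarrow> 'v \<Rightarrow> 'v"
  assumes act_add_right: "x \<in> affine_carrier \<Longrightarrow> act x (v + w) = act x v + act x w"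
    and act_scale_right: "x \<in> affine_carrier \<Longrightarrow> act x (smul c v) = smul c (act x v)"
    and act_add_left:
      "x \<in> affine_carrier \<Longrightarrow> y \<in> affine_carrier \<Longrightarrow> act (x + y) v = act x v + act y v"
    and act_scale_left: "x \<in> affine_carrier \<Longrightarrow> act (affine_scale c x) v = smul c (act x v)"
    and act_bracket:
      "x \<in> affine_carrier \<Longrightarrow> y \<in> affine_carrier \<Longrightarrow>
         act (affine_bracket x y) v = act x (act y v) - act y (act x v)"

definition submodule ::
  "(complex \<Rightarrow> 'v::ab_group_add \<Rightarrow> 'v) \<Rightarrow> (affine \<Rightarrow> 'v \<Rightarrow> 'v) \<Rightarrow> 'v set \<Rightarrow> bool" where
  "submodule smul act U \<longleftrightarrow>
     module.subspace smul U \<and> (\<forall>x\<in>affine_carrier. \<forall>v\<in>U. act x v \<in> U)"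

definition irreducible_module ::
  "(complex \<Rightarrow> 'v::ab_group_add \<Rightarrow> 'v) \<Rightarrow> (affine \<Rightarrow> 'v \<Rightarrow> 'v) \<Rightarrow> bool" where
  "irreducible_module smul act \<longleftrightarrow>
     affine_module smul act \<and> (\<exists>v::'v. v \<noteq> 0) \<and>
     (\<forall>U. submodule smul act U \<longrightarrow> U = {0} \<or> U = UNIV)"

definition weight_space ::
  "(complex \<Rightarrow> 'v::ab_group_add \<Rightarrow> 'v) \<Rightarrow> (affine \<Rightarrow> 'v \<Rightarrow> 'v) \<Rightarrow> weight \<Rightarrow> 'v set" where
  "weight_space smul act \<mu> = {v. \<forall>h. act (cartan_embed h) v = smul (pairing \<mu> h) v}"

definition weights ::
  "(complex \<Rightarrow> 'v::ab_group_add \<Rightarrow> 'v) \<Rightarrow> (affine \<Rightarrow> 'v \<Rightarrow> 'v) \<Rightarrow> weight set" where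
  "weights smul act = {\<mu>. weight_space smul act \<mu> \<noteq> {0}}"

definition highest_weight_module ::
  "(complex \<Rightarrow> 'v::ab_group_add \<Rightarrow> 'v) \<Rightarrow> (affine \<Rightarrow> 'v \<Rightarrow> 'v) \<Rightarrow> weight \<Rightarrow> bool" where
  "highest_weight_module smul act \<Lambda> \<longleftrightarrow>
     affine_module smul act \<and>
     (\<exists>v. v \<noteq> 0 \<and> v \<in> weight_space smul act \<Lambda> \<and> (\<forall>x\<in>n_plus. act x v = 0) \<and>
          (\<forall>U. submodule smul act U \<and> v \<in> U \<longrightarrow> U = UNIV))"

section \<open>Maximal weights and numerical invariants of weights\<close>

definition max_weights :: "weight set \<Rightarrow> weight set" where
  "max_weights P = {\<mu> \<in> P. \<mu> + null_root \<notin> P}"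

definition max_shift :: "weight set \<Rightarrow> weight \<Rightarrow> int \<Rightarrow> int" where
  "max_shift P \<Lambda> m =
     (THE s. \<Lambda> - of_int m *s root1 - of_int s *s null_root \<in> max_weights P)"

definition content :: "weight \<Rightarrow> weight \<Rightarrow> int \<times> int" where
  "content \<Lambda> \<mu> =
     (THE (c0, c1). c0 \<ge> 0 \<and> c1 \<ge> 0 \<and> \<mu> = \<Lambda> - (of_int c0 *s root0 + of_int c1 *s root1))"

definition weight_degree :: "weight \<Rightarrow> weight \<Rightarrow> int" where
  "weight_degree \<Lambda> \<mu> = fst (content \<Lambda> \<mu>) + snd (content \<Lambda> \<mu>)"

definition hub :: "weight \<Rightarrow> complex \<times> complex" where
  "hub \<mu> = (pairing \<mu> coroot0, pairing \<mu> coroot1)"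

definition defect :: "weight \<Rightarrow> weight \<Rightarrow> complex" where
  "defect \<Lambda> \<mu> = (form \<Lambda> \<Lambda> - form \<mu> \<mu>) / 2"

end

theory Submission
  imports Defs
begin

text \<open>
  A singular vector generates, under words in \<open>f\<^sub>0, f\<^sub>1\<close>, a submodule whose weights lie
  below its own weight. By irreducibility the powers \<open>f\<^sub>i\<^bsup>a\<^sub>i + 1\<^esup>\<close> therefore kill the highest
  weight vector, and the Serre relations make \<open>f\<^sub>0, f\<^sub>1\<close> locally nilpotent, so the set of weights is
  stable under both simple reflections. The imaginary root vectors \<open>H t\<close>, \<open>H t\<inverse>\<close> form a Heisenberg
  algebra of nonzero level, so the set of weights is also stable under subtracting \<open>\<delta>\<close>.
  Hence, for fixed \<open>m\<close>, the integers \<open>s\<close> with \<open>\<Lambda> - m\<alpha>\<^sub>1 - s\<delta>\<close> a weight form an up-set. Its minimum is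
  read off the two root strings through \<open>\<Lambda>\<close> when \<open>-a\<^sub>0 \<le> m \<le> a\<^sub>1\<close>; the reflection
  \<open>m \<mapsto> a\<^sub>1 - m\<close> extends this to \<open>m \<le> r\<close>, and the product of the two reflections shifts \<open>m\<close> by \<open>r\<close>.
\<close>

section \<open>Chevalley generators of the loop realization\<close>

text \<open>Keeps the constant 1 in the form of the power \<open>t\<^sup>0\<close>, to which the bracket lemmas apply.\<close>

declare single_one [simp del]

section \<open>Matrix calculus and brackets of homogeneous loop elements\<close>

definition mat2 :: "'a::zero \<Rightarrow> 'a \<Rightarrow> 'a \<Rightarrow> 'a \<Rightarrow> 'a ^ 2 ^ 2" where
  "mat2 a b c d = vector [vector [a, b], vector [c, d]]"

lemma mat2_nth [simp]:
  "mat2 a b c d $ 1 $ 1 = a" "mat2 a b c d $ 1 $ 2 = b"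
  "mat2 a b c d $ 2 $ 1 = c" "mat2 a b c d $ 2 $ 2 = d"
  by (simp_all add: mat2_def)

lemma mat2_eq_iff: "X = mat2 a b c d \<longleftrightarrow> X $ 1 $ 1 = a \<and> X $ 1 $ 2 = b \<and> X $ 2 $ 1 = c \<and> X $ 2 $ 2 = d"
  by (auto simp: vec_eq_iff forall_2)

lemma mat2_zero: "mat2 0 0 0 0 = 0"
  by (simp add: vec_eq_iff forall_2)

lemma trace_mat2: "trace (mat2 a b c d) = a + d"
  by (simp add: trace_def sum_2)

lemma mat2_arith:
  "mat2 a b c d + mat2 a' b' c' d' = mat2 (a + a') (b + b') (c + c') (d + d')"
  "mat2 a b c d - mat2 a' b' c' d' = mat2 (a - a') (b - b') (c - c') (d - d')"
  for a b c d :: "'a::ab_group_add"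
  by (simp_all add: mat2_eq_iff)

lemma mat2_mult:
  "mat2 a b c d ** mat2 a' b' c' d' =
     mat2 (a * a' + b * c') (a * b' + b * d') (c * a' + d * c') (c * b' + d * d')"
  for a b c d :: "'a::semiring_1"
  by (simp add: mat2_eq_iff matrix_matrix_mult_def sum_2)

definition lderiv :: "laurent \<Rightarrow> laurent" where
  "lderiv p = Poly_Mapping.mapp (\<lambda>n c. of_int n * c) p"

lemma lderiv_single [simp]:
  "lderiv (Poly_Mapping.single n c) = Poly_Mapping.single n (of_int n * c)"
  by (rule poly_mapping_eqI) (simp add: lderiv_def lookup_mapp in_keys_iff lookup_single when_def)

lemma lderiv_0 [simp]: "lderiv 0 = 0"
  by (rule poly_mapping_eqI) (simp add: lderiv_def lookup_mapp)

lemma loop_mat2: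
  "loop_scale z (mat2 a b c d) =
     mat2 (Poly_Mapping.single 0 z * a) (Poly_Mapping.single 0 z * b)
          (Poly_Mapping.single 0 z * c) (Poly_Mapping.single 0 z * d)"
  "loop_deriv (mat2 a b c d) = mat2 (lderiv a) (lderiv b) (lderiv c) (lderiv d)"
  by (simp_all add: mat2_eq_iff loop_scale_def loop_deriv_def lderiv_def)

lemma loop_zero [simp]: "loop_scale z 0 = 0" "loop_scale 0 X = 0" "loop_deriv 0 = 0"
  by (simp_all add: vec_eq_iff loop_scale_def loop_deriv_def flip: lderiv_def)

lemma trace_zero [simp]: "trace 0 = 0"
  by (simp add: trace_def)

lemma affine_bracket_0 [simp]: "affine_bracket x 0 = 0"
  by (cases x) (simp add: zero_prod_def trace_zero)

definition loop_E :: "laurent \<Rightarrow> affine" where "loop_E p = (mat2 0 p 0 0, 0, 0)"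
definition loop_F :: "laurent \<Rightarrow> affine" where "loop_F p = (mat2 0 0 p 0, 0, 0)"
definition loop_H :: "laurent \<Rightarrow> affine" where "loop_H p = (mat2 p 0 0 (- p), 0, 0)"

lemma cartan_embed_mat2:
  "cartan_embed h = (mat2 (Poly_Mapping.single 0 (h $ 2 - h $ 1)) 0 0
     (Poly_Mapping.single 0 (h $ 1 - h $ 2)), h $ 1, h $ 3)"
  by (simp add: cartan_embed_def mat2_def)

abbreviation tpow :: "int \<Rightarrow> laurent" where "tpow n \<equiv> Poly_Mapping.single n 1"

lemma gen_e_eq: "gen_e0 = loop_F (tpow 1)" "gen_e1 = loop_E (tpow 0)"
  by (simp_all add: gen_e0_def gen_e1_def loop_F_def loop_E_def mat2_def single_one)

lemma carrier_intros [simp]: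
  "loop_E p \<in> affine_carrier" "loop_F p \<in> affine_carrier" "loop_H p \<in> affine_carrier"
  "cartan_embed h \<in> affine_carrier"
  by (simp_all add: affine_carrier_def loop_E_def loop_F_def loop_H_def cartan_embed_mat2 trace_mat2
      flip: single_add)

lemmas affine_simps = loop_E_def loop_F_def loop_H_def cartan_embed_mat2 mat2_arith mat2_mult loop_mat2
  trace_mat2 mult_single

lemma double_single: "2 * Poly_Mapping.single n c = Poly_Mapping.single n (2 * c)"
  for c :: "'a::comm_semiring_1" and n :: "'b::comm_monoid_add"
  by (simp only: mult_2 single_add)

lemma bracket_cartan:
  "affine_bracket (cartan_embed h) (loop_E (tpow n)) =
     affine_scale (2 * (h $ 2 - h $ 1) + of_int n * h $ 3) (loop_E (tpow n))"
  "affine_bracket (cartan_embed h) (loop_F (tpow n)) =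
     affine_scale (- 2 * (h $ 2 - h $ 1) + of_int n * h $ 3) (loop_F (tpow n))"
  "affine_bracket (cartan_embed h) (loop_H (tpow n)) = affine_scale (of_int n * h $ 3) (loop_H (tpow n))"
  by (simp_all add: affine_simps mat2_eq_iff flip: single_uminus single_add single_diff)
    (simp_all add: algebra_simps)

lemma bracket_HE:
  "affine_bracket (loop_H (tpow m)) (loop_E (tpow n)) = affine_scale 2 (loop_E (tpow (m + n)))"
  "affine_bracket (loop_H (tpow m)) (loop_F (tpow n)) = affine_scale (- 2) (loop_F (tpow (m + n)))"
  by (simp_all add: affine_simps mat2_eq_iff add.commute double_single
      flip: single_uminus single_add single_diff)

text \<open>This encodes k K: since K is the sum of the two simple coroots, the first two
  coordinates agree, and the matrix part of \<open>cartan_embed\<close> vanishes.\<close>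

definition central :: "complex \<Rightarrow> cartan" where
  "central k = vector [k, k, 0]"

lemma bracket_EF:
  "affine_bracket (loop_E (tpow m)) (loop_F (tpow n)) =
     loop_H (tpow (m + n)) + cartan_embed (central (if m + n = 0 then of_int m else 0))"
  by (simp add: affine_simps central_def mat2_eq_iff add.commute[of n] lookup_single
      flip: single_uminus single_add single_diff)

text \<open>The matrix commutator vanishes, so only the residue survives, with value m tr(H H) = 2
  m. This is the Heisenberg relation used in \<open>weights_diff_null_root\<close>.\<close>

lemma bracket_HH:
  "affine_bracket (loop_H (tpow m)) (loop_H (tpow n)) =
     cartan_embed (central (if m + n = 0 then 2 * of_int m else 0))"
  by (simp add: affine_simps central_def mat2_eq_iff add.commute[of n] lookup_single
      lookup_add flip: single_uminus single_add single_diff)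

lemma bracket_EE:
  "affine_bracket (loop_E p) (loop_E q) = 0" "affine_bracket (loop_F p) (loop_F q) = 0"
  by (simp_all add: affine_simps zero_prod_def mat2_eq_iff)

lemma bracket_FE:
  "affine_bracket (loop_F (tpow m)) (loop_E (tpow n)) =
     affine_scale (- 1) (loop_H (tpow (m + n))) +
     cartan_embed (central (if m + n = 0 then of_int m else 0))"
  by (simp add: affine_simps central_def mat2_eq_iff add.commute[of n] lookup_single
      flip: single_uminus single_add single_diff)

lemma loop_gen_add:
  "loop_E (p + q) = loop_E p + loop_E q"
  "loop_F (p + q) = loop_F p + loop_F q"
  "loop_H (p + q) = loop_H p + loop_H q"
  by (simp_all add: affine_simps)

lemma loop_gen_scale:
  "affine_scale c (loop_E (tpow n)) = loop_E (Poly_Mapping.single n c)"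
  "affine_scale c (loop_F (tpow n)) = loop_F (Poly_Mapping.single n c)"
  "affine_scale c (loop_H (tpow n)) = loop_H (Poly_Mapping.single n c)"
  by (simp_all add: affine_simps flip: single_uminus)

section \<open>Generation of the algebra and the Chevalley relations\<close>

lemma laurent_induct [case_names single add]:
  fixes p :: laurent
  assumes "\<And>n c. Q (Poly_Mapping.single n c)" "\<And>p q. Q p \<Longrightarrow> Q q \<Longrightarrow> Q (p + q)"
  shows "Q p"
proof (induction p rule: Poly_Mapping.update_induct)
  case const
  show ?case using assms(1)[of 0 0] by simp
next
  case (update p n c)
  have "Poly_Mapping.update n c p = p + Poly_Mapping.single n c"
    using update.hyps by (intro poly_mapping_eqI)
      (auto simp: lookup_update lookup_add lookup_single in_keys_iff when_def)
  then show ?case using assms update.IH by simp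
qed

lemma affine_carrierE:
  assumes "x \<in> affine_carrier"
  obtains p q s h where "x = loop_E p + loop_F q + loop_H s + cartan_embed h"
proof -
  obtain X k b where x: "x = (X, k, b)" by (cases x)
  with assms have "X $ 2 $ 2 = - X $ 1 $ 1"
    by (simp add: affine_carrier_def trace_def sum_2 eq_neg_iff_add_eq_0 add.commute)
  \<comment> \<open>Equal first two Cartan coordinates contribute no matrix part, so the diagonal is
    carried by \<open>loop_H\<close> alone.\<close>
  then have "x = loop_E (X $ 1 $ 2) + loop_F (X $ 2 $ 1) + loop_H (X $ 1 $ 1) +
      cartan_embed (vector [k, k, b])"
    by (simp add: x affine_simps mat2_eq_iff)
  then show ?thesis by (rule that)
qed

text \<open>Brackets of the generators yield H t and H t^-1 up to central terms. Bracketing with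
  these moves the exponent of a root vector by one in either direction, up to a factor 2 or -2, so
  all monomials are reached. A stabilizer can thus be tested on Chevalley generators and Cartan
  elements.\<close>

lemma affine_carrier_generated:
  assumes add: "\<And>x y. x \<in> S \<Longrightarrow> y \<in> S \<Longrightarrow> x + y \<in> S"
    and scale: "\<And>c x. x \<in> S \<Longrightarrow> affine_scale c x \<in> S"
    and bracket: "\<And>x y. x \<in> S \<Longrightarrow> y \<in> S \<Longrightarrow> affine_bracket x y \<in> S"
    and gens: "loop_E (tpow 0) \<in> S" "loop_F (tpow 1) \<in> S"
      "loop_E (tpow (-1)) \<in> S" "loop_F (tpow 0) \<in> S"
    and cartan: "\<And>h. cartan_embed h \<in> S"
  shows "affine_carrier \<subseteq> S"
proof -
  \<comment> \<open>Removes the central term that comes with a bracket of root vectors.\<close>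
  have cancel: "x \<in> S" if "x + cartan_embed h \<in> S" for x h
  proof -
    have "cartan_embed h + affine_scale (-1) (cartan_embed h) = 0"
      by (simp add: affine_simps zero_prod_def mat2_zero flip: single_uminus single_add)
    then have "x = (x + cartan_embed h) + affine_scale (-1) (cartan_embed h)"
      by (simp add: add.assoc)
    also have "\<dots> \<in> S" by (intro add that scale cartan)
    finally show ?thesis .
  qed
  have EF: "loop_H (tpow (m + n)) \<in> S" if "loop_E (tpow m) \<in> S" "loop_F (tpow n) \<in> S" for m n
    using bracket[OF that] unfolding bracket_EF by (rule cancel)
  have H: "loop_H (tpow 1) \<in> S" "loop_H (tpow (- 1)) \<in> S"
    using EF[of 0 1] EF[of "-1" 0] gens by simp_all
  have half: "x \<in> S" if "affine_scale c x \<in> S" "c \<noteq> 0" for c x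
  proof -
    have "affine_scale (1 / c) (affine_scale c x) = x"
      using that(2) by (cases x) (simp add: loop_scale_def vec_eq_iff mult_single single_one flip: mult.assoc)
    then show ?thesis using scale[OF that(1), of "1 / c"] by simp
  qed
  have E: "loop_E (tpow n) \<in> S" for n
  proof (induction n rule: int_induct[of _ 0])
    case (step1 n)
    then show ?case using half bracket[OF H(1) step1.IH] by (simp add: bracket_HE add.commute)
  next
    case (step2 n)
    then show ?case using half bracket[OF H(2) step2.IH] by (simp add: bracket_HE)
  qed (rule gens)
  have F: "loop_F (tpow n) \<in> S" for n
  proof (induction n rule: int_induct[of _ 0])
    case (step1 n)
    then show ?case using half[of "-2"] bracket[OF H(1) step1.IH] by (simp add: bracket_HE add.commute)
  next
    case (step2 n)
    then show ?case using half[of "-2"] bracket[OF H(2) step2.IH] by (simp add: bracket_HE)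
  qed (rule gens)
  have H: "loop_H (tpow n) \<in> S" for n
    using EF[OF E F, of n 0] by simp
  have "loop_E p \<in> S \<and> loop_F p \<in> S \<and> loop_H p \<in> S" for p
  proof (induction p rule: laurent_induct)
    case (single n c)
    then show ?case using E[of n] F[of n] H[of n] scale[of _ c] by (metis loop_gen_scale)
  qed (simp add: loop_gen_add add)
  then show ?thesis
    by (auto elim!: affine_carrierE intro!: add cartan)
qed

text \<open>The index set of the simple roots is \<open>bool\<close>: \<open>False\<close> stands for 0 and \<open>True\<close> for 1.\<close>

definition chev_e :: "bool \<Rightarrow> affine" where
  "chev_e i = (if i then loop_E (tpow 0) else loop_F (tpow 1))"

text \<open>The partner of t E_21 carries t^-1, so that their bracket has t-degree 0 and picks up
  the K in the coroot K - H.\<close>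

definition chev_f :: "bool \<Rightarrow> affine" where
  "chev_f i = (if i then loop_F (tpow 0) else loop_E (tpow (-1)))"

definition simple_root :: "bool \<Rightarrow> weight" where
  "simple_root i = (if i then root1 else root0)"

definition coroot :: "bool \<Rightarrow> cartan" where
  "coroot i = (if i then coroot1 else coroot0)"

lemma chev_carrier [simp]: "chev_e i \<in> affine_carrier" "chev_f i \<in> affine_carrier"
  by (simp_all add: chev_e_def chev_f_def)

lemma chev_e_n_plus: "chev_e i \<in> n_plus"
  using n_plus.e0 n_plus.e1 by (simp add: chev_e_def gen_e_eq)

lemmas coord_defs = root0_def root1_def coroot0_def coroot1_def Lambda0_def Lambda1_def
  null_root_def pairing_def axis_def sum_3 vec_eq_iff forall_3

lemma pairing_linear:
  "pairing (\<mu> + \<nu>) h = pairing \<mu> h + pairing \<nu> h"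
  "pairing (\<mu> - \<nu>) h = pairing \<mu> h - pairing \<nu> h"
  "pairing (- \<mu>) h = - pairing \<mu> h"
  "pairing (c *s \<mu>) h = c * pairing \<mu> h"
  by (simp_all add: pairing_def sum_3 algebra_simps)

lemma bracket_cartan_chev:
  "affine_bracket (cartan_embed h) (chev_e i) = affine_scale (pairing (simple_root i) h) (chev_e i)"
  "affine_bracket (cartan_embed h) (chev_f i) = affine_scale (pairing (- simple_root i) h) (chev_f i)"
  by (simp_all add: chev_e_def chev_f_def simple_root_def bracket_cartan coord_defs algebra_simps)

lemma bracket_cartan_H:
  "affine_bracket (cartan_embed h) (loop_H (tpow n)) =
     affine_scale (pairing (of_int n *s null_root) h) (loop_H (tpow n))"
  by (simp add: bracket_cartan coord_defs)

lemma bracket_chev_ef: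
  "affine_bracket (chev_e i) (chev_f j) = (if i = j then cartan_embed (coroot i) else 0)"
  by (auto simp: chev_e_def chev_f_def bracket_EF bracket_EE bracket_FE coroot_def)
    (simp_all add: affine_simps central_def coroot0_def coroot1_def axis_def mat2_eq_iff flip: single_uminus)

text \<open>For i = j the inner bracket is already zero. Otherwise three brackets with the same root
  vector of sl_2 shift the H-eigenvalue from one extreme, 2 or -2, past the other, and no central
  term arises.\<close>

lemma serre:
  "affine_bracket (chev_f i) (affine_bracket (chev_f i) (affine_bracket (chev_f i) (chev_f j))) = 0"
  by (cases i; cases j; simp add: chev_f_def bracket_EE;
      simp add: affine_simps zero_prod_def mat2_zero flip: single_uminus single_add single_diff)

lemma pairing_simple_coroot: "pairing (simple_root i) (coroot i) = 2"
  by (simp add: simple_root_def coroot_def coord_defs)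

lemma affine_carrier_closed:
  assumes "x \<in> affine_carrier" "y \<in> affine_carrier"
  shows "x + y \<in> affine_carrier" "affine_scale c x \<in> affine_carrier"
    "affine_bracket x y \<in> affine_carrier"
proof -
  have *: "\<exists>a b c k l. z = (mat2 a b c (- a), k, l)" if "z \<in> affine_carrier" for z
    using that by (cases z) (auto simp: affine_carrier_def trace_def sum_2 mat2_eq_iff
        eq_neg_iff_add_eq_0 add.commute)
  obtain a b c k l where x: "x = (mat2 a b c (- a), k, l)" using *[OF assms(1)] by blast
  obtain a' b' c' k' l' where y: "y = (mat2 a' b' c' (- a'), k', l')" using *[OF assms(2)] by blast
  have [simp]: "lderiv (- p) = - lderiv p" for p
    by (rule poly_mapping_eqI) (simp add: lderiv_def lookup_mapp in_keys_iff when_def)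
  show "x + y \<in> affine_carrier" "affine_scale c x \<in> affine_carrier"
    "affine_bracket x y \<in> affine_carrier" for c
    by (simp_all add: x y affine_carrier_def affine_simps algebra_simps)
qed

definition root_cone :: "weight \<Rightarrow> weight set" where
  "root_cone \<mu> = {\<mu> - (of_nat c0 *s root0 + of_nat c1 *s root1) | c0 c1. True}"

lemma root_cone_refl: "\<mu> \<in> root_cone \<mu>"
  unfolding root_cone_def by (intro CollectI exI[of _ 0]) simp

lemma root_cone_step: "\<nu> \<in> root_cone \<mu> \<Longrightarrow> \<nu> - simple_root i \<in> root_cone \<mu>"
  unfolding root_cone_def simple_root_def
  by (cases i) (force simp: vector_sadd_rdistrib algebra_simps intro: exI[of _ "Suc _"])+

section \<open>Weight spaces and singular vectors\<close>

context affine_module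
begin

abbreviation "V \<equiv> weight_space smul act"

lemma act_0 [simp]: "x \<in> affine_carrier \<Longrightarrow> act x 0 = 0"
  using act_add_right[of x 0 0] by simp

lemma act_zero [simp]: "act 0 v = 0"
  using act_add_left[of 0 0 v] by (simp add: affine_carrier_def zero_prod_def trace_def)

lemma act_diff_right: "x \<in> affine_carrier \<Longrightarrow> act x (v - w) = act x v - act x w"
  using act_add_right[of x "v - w" w] by simp

lemma act_comm:
  "x \<in> affine_carrier \<Longrightarrow> y \<in> affine_carrier \<Longrightarrow>
    act x (act y v) = act y (act x v) + act (affine_bracket x y) v"
  by (simp add: act_bracket)

lemma weight_spaceD: "v \<in> V \<mu> \<Longrightarrow> act (cartan_embed h) v = smul (pairing \<mu> h) v"
  by (simp add: weight_space_def)

lemma zero_in_weight_space [simp]: "0 \<in> V \<mu>"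
  by (simp add: weight_space_def)

lemma in_weights_iff: "\<mu> \<in> weights smul act \<longleftrightarrow> (\<exists>v \<in> V \<mu>. v \<noteq> 0)"
  using zero_in_weight_space[of \<mu>] by (auto simp: weights_def)

lemma act_weight_space:
  assumes X: "X \<in> affine_carrier"
    and ad: "\<And>h. affine_bracket (cartan_embed h) X = affine_scale (pairing \<beta> h) X"
    and v: "v \<in> V \<mu>"
  shows "act X v \<in> V (\<mu> + \<beta>)"
  using X v by (simp add: weight_space_def act_comm[of _ X] ad act_scale_left act_scale_right
      pairing_linear scale_left_distrib)

lemma act_chev_weight_space:
  "v \<in> V \<mu> \<Longrightarrow> act (chev_e i) v \<in> V (\<mu> + simple_root i)"
  "v \<in> V \<mu> \<Longrightarrow> act (chev_f i) v \<in> V (\<mu> - simple_root i)"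
  "v \<in> V \<mu> \<Longrightarrow> act (loop_H (tpow n)) v \<in> V (\<mu> + of_int n *s null_root)"
  using act_weight_space[OF chev_carrier(1) bracket_cartan_chev(1)]
    act_weight_space[OF chev_carrier(2) bracket_cartan_chev(2)]
    act_weight_space[OF carrier_intros(3) bracket_cartan_H]
  by simp_all

lemma weight_space_scale: "v \<in> V \<mu> \<Longrightarrow> smul c v \<in> V \<mu>"
  by (simp add: weight_space_def act_scale_right mult.commute)

text \<open>Applying \<open>h - \<omega>(h)\<close> kills one of the summands.\<close>

lemma weight_vector_sum_eq_0:
  assumes "finite T" "x \<in> V \<mu>" "x = (\<Sum>b\<in>T. g b)"
    and "\<And>b. b \<in> T \<Longrightarrow> g b \<in> V (\<omega> b) \<and> \<omega> b \<noteq> \<mu>"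
  shows "x = 0"
  using assms
proof (induction T arbitrary: x g rule: finite_induct)
  case (insert b T)
  from insert.prems(3)[of b] obtain h where h: "pairing (\<omega> b) h \<noteq> pairing \<mu> h"
  proof -
    from insert.prems(3)[of b] obtain i where "\<omega> b $ i \<noteq> \<mu> $ i" by (auto simp: vec_eq_iff)
    moreover have "pairing \<nu> (axis i 1) = \<nu> $ i" for \<nu> :: weight
      by (simp add: pairing_def axis_def if_distrib cong: if_cong)
    ultimately show ?thesis using that by metis
  qed
  define D where "D v = act (cartan_embed h) v - smul (pairing (\<omega> b) h) v" for v
  have D_add: "D (v + w) = D v + D w" for v w
    by (simp add: D_def act_add_right scale_right_distrib)
  have D0: "D 0 = 0" by (simp add: D_def)
  have D: "D v = smul (pairing \<nu> h - pairing (\<omega> b) h) v" if "v \<in> V \<nu>" for v \<nu>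
    using that by (simp add: D_def weight_spaceD scale_left_diff_distrib)
  have "D x = D (g b) + D (\<Sum>b\<in>T. g b)"
    using insert.hyps by (simp add: insert.prems(2) D_add)
  also have "D (\<Sum>b\<in>T. g b) = (\<Sum>b\<in>T. D (g b))"
    using insert.hyps(1) by (induction T rule: finite_induct) (simp_all add: D0 D_add)
  also have "D (g b) = 0" using D[of "g b" "\<omega> b"] insert.prems(3) by simp
  finally have "D x = (\<Sum>b\<in>T. D (g b))" by simp
  moreover have "D x \<in> V \<mu>" using D insert.prems(1) weight_space_scale by simp
  moreover have "D (g c) \<in> V (\<omega> c) \<and> \<omega> c \<noteq> \<mu>" if "c \<in> T" for c
    using D[of "g c" "\<omega> c"] insert.prems(3)[of c] that weight_space_scale by simp
  ultimately have "D x = 0" by (intro insert.IH[of "D x" "\<lambda>b. D (g b)"])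
  then show ?case using D[OF insert.prems(1)] h by simp
qed simp

text \<open>Vectors of pairwise distinct weights are independent, so an expansion of
  \<open>x\<close> into weight vectors must involve the weight of \<open>x\<close>. Applied to
  \<open>words\<close>, this bounds the weights of the module.\<close>

lemma weight_in_span:
  assumes "x \<in> span B" "x \<in> V \<mu>" "x \<noteq> 0"
    and B: "\<And>b. b \<in> B \<Longrightarrow> \<exists>\<nu>\<in>S. b \<in> V \<nu>"
  shows "\<mu> \<in> S"
proof (rule ccontr)
  assume \<mu>: "\<mu> \<notin> S"
  from assms(1) obtain T r where T: "finite T" "T \<subseteq> B" "x = (\<Sum>a\<in>T. smul (r a) a)"
    by (auto simp: span_explicit)
  from B obtain \<omega> where \<omega>: "\<And>b. b \<in> B \<Longrightarrow> \<omega> b \<in> S \<and> b \<in> V (\<omega> b)" by metis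
  have "x = 0"
    by (rule weight_vector_sum_eq_0[OF T(1) assms(2) T(3)])
      (use \<omega> T(2) \<mu> weight_space_scale in blast)
  with assms(3) show False by contradiction
qed

definition singular :: "weight \<Rightarrow> 'v \<Rightarrow> bool" where
  "singular \<mu> w \<longleftrightarrow> w \<in> V \<mu> \<and> (\<forall>i. act (chev_e i) w = 0)"

inductive_set words :: "'v \<Rightarrow> 'v set" for w where
  base: "w \<in> words w"
| step: "x \<in> words w \<Longrightarrow> act (chev_f i) x \<in> words w"

lemma words_weight:
  "x \<in> words w \<Longrightarrow> w \<in> V \<mu> \<Longrightarrow> \<exists>\<nu>\<in>root_cone \<mu>. x \<in> V \<nu>"
  by (induction rule: words.induct)
   (use root_cone_refl root_cone_step act_chev_weight_space(2) in blast)+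

lemma act_span_closed:
  assumes "X \<in> affine_carrier" "\<And>b. b \<in> B \<Longrightarrow> act X b \<in> span B" "v \<in> span B"
  shows "act X v \<in> span B"
  using assms(3)
proof (induction rule: span_induct_alt)
  case base
  then show ?case using assms(1) by (simp add: span_zero)
next
  case (step c x y)
  then show ?case using assms(1,2)
    by (simp add: act_add_right act_scale_right span_add span_scale)
qed

text \<open>The stabilizer \<open>S\<close> of the span is closed under sums, scalings and brackets,
  so it suffices that it contains the generators. Cartan elements act on words by scalars, the f_i
  lengthen words, and an e_i is moved to the right until it reaches \<open>w\<close> and kills
  it.\<close>

lemma submodule_span_words:
  assumes "singular \<mu> w"
  shows "submodule smul act (span (words w))"
proof -
  let ?U = "span (words w)"
  define S where "S = {x \<in> affine_carrier. \<forall>v\<in>?U. act x v \<in> ?U}"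
  have S: "x \<in> S" if "x \<in> affine_carrier" "\<And>b. b \<in> words w \<Longrightarrow> act x b \<in> ?U" for x
    using act_span_closed that by (auto simp: S_def)
  have w: "w \<in> V \<mu>" "act (chev_e i) w = 0" for i using assms by (auto simp: singular_def)
  have cartan: "cartan_embed h \<in> S" for h
  proof (rule S)
    fix b assume "b \<in> words w"
    moreover from words_weight[OF this w(1)] obtain \<nu> where "b \<in> V \<nu>" by blast
    ultimately show "act (cartan_embed h) b \<in> ?U"
      by (simp add: weight_spaceD span_scale span_base)
  qed simp
  have f: "chev_f i \<in> S" for i
    by (rule S) (auto intro: span_base words.step)
  have e: "chev_e i \<in> S" for i
  proof (rule S)
    fix b assume "b \<in> words w"
    then show "act (chev_e i) b \<in> ?U"
    proof induction
      case base
      then show ?case using w by (simp add: span_zero)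
    next
      case (step x j)
      \<comment> \<open>Exchanging e_i and f_j costs at most a coroot, which is already known to
        preserve the span.\<close>
      have "act (chev_e i) (act (chev_f j) x) = act (chev_f j) (act (chev_e i) x) +
          (if i = j then act (cartan_embed (coroot i)) x else 0)"
        by (simp add: act_comm[of "chev_e i" "chev_f j"] bracket_chev_ef)
      also have "\<dots> \<in> ?U"
        using step span_base[OF step.hyps] f[of j] cartan by (auto simp: S_def span_zero intro!: span_add)
      finally show ?case .
    qed
  qed simp
  have "affine_carrier \<subseteq> S"
  proof (rule affine_carrier_generated)
    show "loop_E (tpow 0) \<in> S" "loop_F (tpow 1) \<in> S" "loop_E (tpow (- 1)) \<in> S" "loop_F (tpow 0) \<in> S"
      using e[of True] e[of False] f[of True] f[of False] by (simp_all add: chev_e_def chev_f_def)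
    show "x + y \<in> S" "affine_bracket x y \<in> S" if "x \<in> S" "y \<in> S" for x y
      using that by (auto simp: S_def affine_carrier_closed act_add_left act_bracket
          intro: span_add span_diff)
    show "affine_scale c x \<in> S" if "x \<in> S" for c x
      using that by (auto simp: S_def affine_carrier_closed act_scale_left span_scale)
  qed (rule cartan)
  then show ?thesis
    by (auto simp: submodule_def S_def)
qed

end

section \<open>Integrability\<close>

context vector_space
begin

context
  fixes E F H :: "'b \<Rightarrow> 'b"
  assumes E_scale: "\<And>c x. E (scale c x) = scale c (E x)"
    and F_scale: "\<And>c x. F (scale c x) = scale c (F x)"
    and EF: "\<And>x. E (F x) = F (E x) + H x"
    and HE: "\<And>x. H (E x) = E (H x) + scale 2 (E x)"
    and HF: "\<And>x. H (F x) = F (H x) - scale 2 (F x)"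
begin

lemma sl2_weight_F:
  assumes "H w = scale c w"
  shows "H ((F ^^ j) w) = scale (c - 2 * of_nat j) ((F ^^ j) w)"
proof (induction j)
  case (Suc j)
  then show ?case by (simp add: HF F_scale algebra_simps flip: scale_left_diff_distrib)
qed (simp add: assms)

lemma sl2_weight_E:
  assumes "H w = scale c w"
  shows "H ((E ^^ j) w) = scale (c + 2 * of_nat j) ((E ^^ j) w)"
proof (induction j)
  case (Suc j)
  then show ?case by (simp add: HE E_scale algebra_simps flip: scale_left_distrib)
qed (simp add: assms)

text \<open>Each exchange of \<open>E\<close> with an \<open>F\<close> adds the
  \<open>H\<close>-eigenvalue at that place, so the coefficient is the sum of c - 2 k over k = 0,
  ..., j.\<close>

lemma sl2_string:
  assumes "H w = scale c w" "E w = 0"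
  shows "E ((F ^^ Suc j) w) = scale (of_nat (Suc j) * (c - of_nat j)) ((F ^^ j) w)"
proof (induction j)
  case 0
  have "F 0 = 0" using F_scale[of 0 0] by simp
  then show ?case using assms by (simp add: EF)
next
  case (Suc j)
  have "E ((F ^^ Suc (Suc j)) w) = F (E ((F ^^ Suc j) w)) + H ((F ^^ Suc j) w)"
    by (simp add: EF)
  also have "\<dots> = scale (of_nat (Suc j) * (c - of_nat j) + (c - 2 * of_nat (Suc j))) ((F ^^ Suc j) w)"
    unfolding Suc.IH sl2_weight_F[OF assms(1)] scale_left_distrib by (simp add: F_scale)
  finally show ?case by (simp add: algebra_simps)
qed

end

end

context affine_module
begin

lemma act_minus_right: "x \<in> affine_carrier \<Longrightarrow> act x (- v) = - act x v"
  using act_diff_right[of x 0 v] by simp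

lemma funpow_chev_weight_space:
  assumes "v \<in> V \<mu>"
  shows "(act (chev_e i) ^^ k) v \<in> V (\<mu> + of_nat k *s simple_root i)"
    and "(act (chev_f i) ^^ k) v \<in> V (\<mu> - of_nat k *s simple_root i)"
proof (induction k)
  case (Suc k)
  case 1 show ?case using act_chev_weight_space(1)[OF Suc.IH(1)]
    by (simp add: vector_sadd_rdistrib algebra_simps)
  case 2 show ?case using act_chev_weight_space(2)[OF Suc.IH(2)]
    by (simp add: vector_sadd_rdistrib algebra_simps)
qed (simp_all add: assms)

lemma chev_sl2:
  "act (chev_e i) (smul c x) = smul c (act (chev_e i) x)"
  "act (chev_f i) (smul c x) = smul c (act (chev_f i) x)"
  "act (chev_e i) (act (chev_f i) x) =
     act (chev_f i) (act (chev_e i) x) + act (cartan_embed (coroot i)) x"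
  "act (cartan_embed (coroot i)) (act (chev_e i) x) =
     act (chev_e i) (act (cartan_embed (coroot i)) x) + smul 2 (act (chev_e i) x)"
  "act (cartan_embed (coroot i)) (act (chev_f i) x) =
     act (chev_f i) (act (cartan_embed (coroot i)) x) - smul 2 (act (chev_f i) x)"
proof -
  let ?h = "cartan_embed (coroot i)"
  show "act (chev_e i) (smul c x) = smul c (act (chev_e i) x)"
    "act (chev_f i) (smul c x) = smul c (act (chev_f i) x)"
    by (simp_all add: act_scale_right)
  show "act (chev_e i) (act (chev_f i) x) = act (chev_f i) (act (chev_e i) x) + act ?h x"
    by (simp add: act_comm[of "chev_e i" "chev_f i"] bracket_chev_ef)
  show "act ?h (act (chev_e i) x) = act (chev_e i) (act ?h x) + smul 2 (act (chev_e i) x)"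
    by (simp add: act_comm[of ?h] bracket_cartan_chev act_scale_left pairing_simple_coroot)
  show "act ?h (act (chev_f i) x) = act (chev_f i) (act ?h x) - smul 2 (act (chev_f i) x)"
    by (simp add: act_comm[of ?h] bracket_cartan_chev act_scale_left pairing_simple_coroot pairing_linear)
qed

text \<open>The string coefficient (j + 1)(n - j) is nonzero for j < n, so \<open>E\<close> recovers
  a nonzero vector from the next power of \<open>F\<close>.\<close>

lemma sl2_nonzero:
  fixes E F H :: "'v \<Rightarrow> 'v"
  assumes sl2: "\<And>c x. E (smul c x) = smul c (E x)" "\<And>c x. F (smul c x) = smul c (F x)"
    "\<And>x. E (F x) = F (E x) + H x"
    "\<And>x. H (E x) = E (H x) + smul 2 (E x)" "\<And>x. H (F x) = F (H x) - smul 2 (F x)"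
    and w: "H w = smul (of_nat n) w" "E w = 0" "w \<noteq> 0" and "j \<le> n"
  shows "(F ^^ j) w \<noteq> 0"
  using \<open>j \<le> n\<close>
proof (induction j)
  case (Suc j)
  have "E ((F ^^ Suc j) w) = smul (of_nat (Suc j) * (of_nat n - of_nat j)) ((F ^^ j) w)"
    by (rule sl2_string[of E F H w "of_nat n" j, OF sl2 w(1,2)])
  moreover have "of_nat (Suc j) * (of_nat n - of_nat j) \<noteq> (0 :: complex)"
    using Suc.prems by (simp del: of_nat_Suc flip: of_nat_diff)
  moreover have "E 0 = 0" using sl2(1)[of 0 0] by simp
  ultimately show ?case using Suc by auto
qed (simp add: w)

text \<open>Climbing with \<open>E\<close> as far as possible gives a vector of
  \<open>H\<close>-eigenvalue n + 2 k killed by \<open>E\<close>. It survives n + 2 k applications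
  of \<open>F\<close>, hence also the n + k that lead to the eigenvalue -n.\<close>

lemma sl2_reflect:
  fixes E F H :: "'v \<Rightarrow> 'v"
  assumes sl2: "\<And>c x. E (smul c x) = smul c (E x)" "\<And>c x. F (smul c x) = smul c (F x)"
    "\<And>x. E (F x) = F (E x) + H x"
    "\<And>x. H (E x) = E (H x) + smul 2 (E x)" "\<And>x. H (F x) = F (H x) - smul 2 (F x)"
    and v: "H v = smul (of_nat n) v" "v \<noteq> 0" and nil: "\<exists>N. (E ^^ N) v = 0"
  shows "\<exists>k. (F ^^ (n + k)) ((E ^^ k) v) \<noteq> 0"
proof -
  \<comment> \<open>The successor makes \<open>k\<close> the last exponent with a nonzero power;
    exponent 0 cannot give zero because \<open>v\<close> is nonzero.\<close>
  define k where "k = (LEAST N. (E ^^ Suc N) v = 0)"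
  have "\<exists>N. (E ^^ Suc N) v = 0"
    using nil v(2) by (metis funpow_0 not0_implies_Suc)
  then have 1: "(E ^^ Suc k) v = 0"
    unfolding k_def by (rule LeastI_ex)
  have 2: "(E ^^ k) v \<noteq> 0"
  proof (cases k)
    case (Suc l)
    then show ?thesis using not_less_Least[of l "\<lambda>N. (E ^^ Suc N) v = 0"] by (simp add: k_def)
  qed (simp add: v)
  have "H ((E ^^ k) v) = smul (of_nat (n + 2 * k)) ((E ^^ k) v)"
    using sl2_weight_E[of E F H v "of_nat n" k, OF sl2 v(1)] by simp
  then have "(F ^^ (n + k)) ((E ^^ k) v) \<noteq> 0"
    by (rule sl2_nonzero[of E F H "(E ^^ k) v" "n + 2 * k", OF sl2]) (use 1 2 in simp_all)
  then show ?thesis ..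
qed

lemma weights_chev_f_string:
  assumes "singular \<mu> w" "w \<noteq> 0" "pairing \<mu> (coroot i) = of_nat n" "j \<le> n"
  shows "\<mu> - of_nat j *s simple_root i \<in> weights smul act"
proof -
  have "(act (chev_f i) ^^ j) w \<noteq> 0"
    by (rule sl2_nonzero[of "act (chev_e i)" "act (chev_f i)" "act (cartan_embed (coroot i))" w n,
          OF chev_sl2 _ _ assms(2,4)])
      (use assms in \<open>auto simp: singular_def weight_spaceD\<close>)
  then show ?thesis
    using assms(1) funpow_chev_weight_space(2) by (auto simp: in_weights_iff singular_def)
qed

text \<open>The target is the image of \<open>\<mu>\<close> under the i-th simple reflection. The
  sign of \<open>n\<close> decides whether the net motion along the root string is by f_i or by
  e_i.\<close>

lemma weights_reflect:
  assumes nil: "\<And>v. v \<in> V \<mu> \<Longrightarrow>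
      (\<exists>N. (act (chev_e i) ^^ N) v = 0) \<and> (\<exists>N. (act (chev_f i) ^^ N) v = 0)"
    and "\<mu> \<in> weights smul act" and n: "pairing \<mu> (coroot i) = of_int n"
  shows "\<mu> - of_int n *s simple_root i \<in> weights smul act"
proof -
  obtain v where v: "v \<in> V \<mu>" "v \<noteq> 0" using assms(2) by (auto simp: in_weights_iff)
  have hv: "act (cartan_embed (coroot i)) v = smul (of_int n) v" using v n by (simp add: weight_spaceD)
  show ?thesis
  proof (cases "n \<ge> 0")
    case True
    then have "\<exists>k. (act (chev_f i) ^^ (nat n + k)) ((act (chev_e i) ^^ k) v) \<noteq> 0"
      by (intro sl2_reflect[of "act (chev_e i)" "act (chev_f i)" "act (cartan_embed (coroot i))" v,
            OF chev_sl2])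
        (use True hv v nil[OF v(1)] in simp_all)
    then obtain k where k: "(act (chev_f i) ^^ (nat n + k)) ((act (chev_e i) ^^ k) v) \<noteq> 0" ..
    have "(act (chev_f i) ^^ (nat n + k)) ((act (chev_e i) ^^ k) v) \<in>
        V (\<mu> + of_nat k *s simple_root i - of_nat (nat n + k) *s simple_root i)"
      by (intro funpow_chev_weight_space v)
    also have "\<mu> + of_nat k *s simple_root i - of_nat (nat n + k) *s simple_root i =
        \<mu> - of_int n *s simple_root i"
      using True by (simp add: vector_sadd_rdistrib)
    finally show ?thesis using k by (auto simp: in_weights_iff)
  next
    case False
    \<comment> \<open>Exchanging e_i and f_i and negating the coroot gives an sl_2 triple again, for
      which the eigenvalue -n is positive.\<close>
    let ?H = "\<lambda>x. - act (cartan_embed (coroot i)) x"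
    have "\<exists>k. (act (chev_e i) ^^ (nat (- n) + k)) ((act (chev_f i) ^^ k) v) \<noteq> 0"
      by (intro sl2_reflect[of "act (chev_f i)" "act (chev_e i)" ?H v])
        (use hv v nil[OF v(1)] False in \<open>simp_all add: chev_sl2 act_minus_right\<close>)
    then obtain k where k: "(act (chev_e i) ^^ (nat (- n) + k)) ((act (chev_f i) ^^ k) v) \<noteq> 0" ..
    have "(act (chev_e i) ^^ (nat (- n) + k)) ((act (chev_f i) ^^ k) v) \<in>
        V (\<mu> - of_nat k *s simple_root i + of_nat (nat (- n) + k) *s simple_root i)"
      by (intro funpow_chev_weight_space v)
    also have "\<mu> - of_nat k *s simple_root i + of_nat (nat (- n) + k) *s simple_root i =
        \<mu> - of_int n *s simple_root i"
      using False by (simp add: vector_sadd_rdistrib vector_ssub_ldistrib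
          vector_scalar_mult_def vec_eq_iff algebra_simps)
    finally show ?thesis using k by (auto simp: in_weights_iff)
  qed
qed

section \<open>Local nilpotency of the lowering generators\<close>

definition nilpotent_on :: "affine \<Rightarrow> 'v \<Rightarrow> bool" where
  "nilpotent_on X v \<longleftrightarrow> (\<exists>N. (act X ^^ N) v = 0)"

context
  fixes X assumes X: "X \<in> affine_carrier"
begin

lemma funpow_act_linear:
  "(act X ^^ N) 0 = 0"
  "(act X ^^ N) (v + w) = (act X ^^ N) v + (act X ^^ N) w"
  "(act X ^^ N) (smul c v) = smul c ((act X ^^ N) v)"
  using X by (induction N) (simp_all add: act_add_right act_scale_right)

lemma nilpotent_on_mono:
  assumes "(act X ^^ N) v = 0" "N \<le> M"
  shows "(act X ^^ M) v = 0"
proof -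
  have "(act X ^^ M) v = (act X ^^ (M - N)) ((act X ^^ N) v)"
    using assms(2) by (simp flip: funpow_add comp_apply[of "act X ^^ (M - N)"])
  then show ?thesis using assms by (simp add: funpow_act_linear)
qed

lemma subspace_nilpotent_on: "subspace {v. nilpotent_on X v}"
proof (rule subspaceI)
  show "0 \<in> {v. nilpotent_on X v}"
    unfolding nilpotent_on_def by (simp add: funpow_act_linear)
next
  fix c v assume "v \<in> {v. nilpotent_on X v}"
  then obtain N where "(act X ^^ N) v = 0" by (auto simp: nilpotent_on_def)
  then have "(act X ^^ N) (smul c v) = 0" by (simp add: funpow_act_linear)
  then show "smul c v \<in> {v. nilpotent_on X v}" unfolding nilpotent_on_def by blast
next
  fix v w assume "v \<in> {v. nilpotent_on X v}" "w \<in> {v. nilpotent_on X v}"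
  then obtain N M where "(act X ^^ N) v = 0" "(act X ^^ M) w = 0"
    by (auto simp: nilpotent_on_def)
  then have "(act X ^^ (max N M)) v = 0" "(act X ^^ (max N M)) w = 0"
    using nilpotent_on_mono by simp_all
  then have "(act X ^^ (max N M)) (v + w) = 0"
    by (simp add: funpow_act_linear)
  then show "v + w \<in> {v. nilpotent_on X v}" unfolding nilpotent_on_def by blast
qed

text \<open>Induction on the exponent killing \<open>v\<close>, using X Y v = Y X v + [X, Y] v: the
  first term has a smaller exponent, the second is covered by \<open>ad\<close>. This reduces a
  claim about \<open>Y\<close> to the same claim about [X, Y].\<close>

lemma nilpotent_on_act:
  assumes Y: "Y \<in> affine_carrier"
    and ad: "\<And>v. nilpotent_on X v \<Longrightarrow> nilpotent_on X (act (affine_bracket X Y) v)"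
    and "nilpotent_on X v"
  shows "nilpotent_on X (act Y v)"
proof -
  obtain N where "(act X ^^ N) v = 0" using assms(3) by (auto simp: nilpotent_on_def)
  then show ?thesis
  proof (induction N arbitrary: v)
    case 0
    then show ?case using Y subspace_0[OF subspace_nilpotent_on] by simp
  next
    case (Suc N)
    then have *: "(act X ^^ N) (act X v) = 0" by (simp add: funpow_swap1)
    have "nilpotent_on X v" using Suc.prems unfolding nilpotent_on_def by blast
    then have "nilpotent_on X (act X (act Y v))"
      using X Y subspace_add[OF subspace_nilpotent_on] Suc.IH[OF *] ad by (simp add: act_comm[of X Y])
    then obtain M where "(act X ^^ M) (act X (act Y v)) = 0" by (auto simp: nilpotent_on_def)
    then have "(act X ^^ Suc M) (act Y v) = 0" by (simp add: funpow_swap1)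
    then show ?case unfolding nilpotent_on_def by blast
  qed
qed

end

text \<open>The triple bracket with f_i vanishes by \<open>serre\<close>, and
  \<open>nilpotent_on_act\<close> leads back from it to f_j, one bracket at a time.\<close>

lemma nilpotent_on_chev_f:
  assumes "nilpotent_on (chev_f i) v"
  shows "nilpotent_on (chev_f i) (act (chev_f j) v)"
proof -
  let ?f = "chev_f i" and ?ad = "affine_bracket (chev_f i)"
  have c: "?f \<in> affine_carrier" "?ad x \<in> affine_carrier" if "x \<in> affine_carrier" for x
    using that by (simp_all add: affine_carrier_closed)
  have 3: "nilpotent_on ?f (act (?ad (?ad (?ad (chev_f j)))) v)" for v
    using subspace_0[OF subspace_nilpotent_on[of ?f]] by (simp add: serre)
  have 2: "nilpotent_on ?f (act (?ad (?ad (chev_f j))) v)" if "nilpotent_on ?f v" for v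
    by (rule nilpotent_on_act[OF _ _ 3 that]) (simp_all add: c)
  have 1: "nilpotent_on ?f (act (?ad (chev_f j)) v)" if "nilpotent_on ?f v" for v
    by (rule nilpotent_on_act[OF _ _ 2 that]) (simp_all add: c)
  show ?thesis
    by (rule nilpotent_on_act[OF _ _ 1 assms]) simp_all
qed

lemma nilpotent_on_span_words:
  assumes "nilpotent_on (chev_f i) w" "x \<in> span (words w)"
  shows "nilpotent_on (chev_f i) x"
proof -
  have "nilpotent_on (chev_f i) b" if "b \<in> words w" for b
    using that by induction (auto intro: assms nilpotent_on_chev_f)
  then have "words w \<subseteq> {v. nilpotent_on (chev_f i) v}" by blast
  then have "span (words w) \<subseteq> {v. nilpotent_on (chev_f i) v}"
    by (rule span_minimal[OF _ subspace_nilpotent_on]) simp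
  then show ?thesis using assms(2) by blast
qed

end

section \<open>The weights of an irreducible highest weight module\<close>

lemma root_eq: "root0 = null_root - root1"
  by (simp add: coord_defs)

lemma root_comb_eq_iff:
  "c *s root1 + d *s null_root = c' *s root1 + d' *s null_root \<longleftrightarrow> c = c' \<and> d = d'"
  by (auto simp: coord_defs)

locale irreducible_highest_weight = affine_module smul act
  for smul :: "complex \<Rightarrow> 'v::ab_group_add \<Rightarrow> 'v" and act +
  fixes a :: "bool \<Rightarrow> nat" and \<Lambda> :: weight and vac :: 'v
  assumes \<Lambda>: "\<Lambda> = of_nat (a False) *s Lambda0 + of_nat (a True) *s Lambda1"
    and irreducible: "submodule smul act U \<Longrightarrow> U = {0} \<or> U = UNIV"
    and vac: "singular \<Lambda> vac" "vac \<noteq> 0"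
begin

abbreviation "Wts \<equiv> weights smul act"

text \<open>Here \<open>m\<close> names a column parallel to \<open>null_root\<close> and
  \<open>s\<close> the depth in it. As \<open>root0\<close> = \<open>null_root\<close> -
  \<open>root1\<close>, the coefficients of \<open>root0\<close> and \<open>root1\<close> subtracted
  from \<open>\<Lambda>\<close> are s and s + m.\<close>

definition wt :: "int \<Rightarrow> int \<Rightarrow> weight" where
  "wt m s = \<Lambda> - of_int m *s root1 - of_int s *s null_root"

lemma wt_eq_iff: "wt m s = wt m' s' \<longleftrightarrow> m = m' \<and> s = s'"
proof -
  have "wt m s = wt m' s' \<longleftrightarrow> of_int m *s root1 + of_int s *s null_root =
      of_int m' *s root1 + of_int s' *s null_root"
    by (auto simp: wt_def algebra_simps)
  then show ?thesis by (simp add: root_comb_eq_iff)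
qed

lemma wt_add_root:
  "wt m s + of_int k *s simple_root i = (if i then wt (m - k) s else wt (m + k) (s - k))"
  "wt m s + of_int k *s null_root = wt m (s - k)"
  by (auto simp: wt_def simple_root_def root_eq vec_eq_iff algebra_simps)

lemma wt_diff_root:
  "wt m s - of_int k *s simple_root i = (if i then wt (m + k) s else wt (m - k) (s + k))"
  by (auto simp: wt_def simple_root_def root_eq vec_eq_iff algebra_simps)

lemma wt_0: "wt 0 0 = \<Lambda>"
  by (simp add: wt_def)

lemma pairing_wt:
  "pairing (wt m s) (coroot i) = of_int (if i then int (a True) - 2 * m else int (a False) + 2 * m)"
  "pairing (wt m s) (central k) = k * of_int (int (a False) + int (a True))"
  unfolding wt_def by (auto simp: \<Lambda> coroot_def central_def coord_defs algebra_simps)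

text \<open>The two inequalities say that the coefficients s' - s of \<open>root0\<close> and (s' +
  m') - (s + m) of \<open>root1\<close> are nonnegative.\<close>

lemma root_cone_wt: "\<nu> \<in> root_cone (wt m s) \<longleftrightarrow>
  (\<exists>m' s'. \<nu> = wt m' s' \<and> s \<le> s' \<and> s + m \<le> s' + m')"
proof -
  have *: "wt m s - (of_nat c0 *s root0 + of_nat c1 *s root1) =
      wt (m + int c1 - int c0) (s + int c0)" for c0 c1
    by (simp add: wt_def root_eq vec_eq_iff algebra_simps)
  have "\<exists>c0 c1. wt m' s' = wt (m + int c1 - int c0) (s + int c0)"
    if "s \<le> s'" "s + m \<le> s' + m'" for m' s'
    using that by (intro exI[of _ "nat (s' - s)"] exI[of _ "nat (s' + m' - s - m)"]) simp
  then show ?thesis unfolding root_cone_def * by fastforce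
qed

lemma span_words_singular:
  assumes "singular \<mu> w" "w \<noteq> 0"
  shows "span (words w) = UNIV"
  using irreducible[OF submodule_span_words[OF assms(1)]] assms(2) words.base[of w] span_base by blast

text \<open>By irreducibility the words on any nonzero singular vector span the module. Used for
  \<open>vac\<close> as an upper bound on weights, and for other singular vectors to refute their
  existence.\<close>

lemma weights_subset_root_cone:
  assumes "singular \<mu> w" "w \<noteq> 0"
  shows "Wts \<subseteq> root_cone \<mu>"
proof
  fix \<nu> assume "\<nu> \<in> Wts"
  then obtain x where x: "x \<in> V \<nu>" "x \<noteq> 0" by (auto simp: in_weights_iff)
  show "\<nu> \<in> root_cone \<mu>"
  proof (rule weight_in_span[OF _ x])
    show "x \<in> span (words w)" using span_words_singular[OF assms] by simp
    show "\<exists>\<nu>\<in>root_cone \<mu>. b \<in> V \<nu>" if "b \<in> words w" for b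
      using words_weight[OF that] assms(1) by (simp add: singular_def)
  qed
qed

lemma weightsD:
  assumes "\<mu> \<in> Wts"
  shows "\<exists>m s. \<mu> = wt m s \<and> 0 \<le> s \<and> 0 \<le> s + m"
  using weights_subset_root_cone[OF vac] assms root_cone_wt[of _ 0 0] by (auto simp: wt_0)

lemma wt_in_weightsD: "wt m s \<in> Wts \<Longrightarrow> 0 \<le> s \<and> 0 \<le> s + m"
  using weightsD[of "wt m s"] by (auto simp: wt_eq_iff)

lemma hw_in_weights: "wt 0 0 \<in> Wts"
  using vac by (auto simp: wt_0 in_weights_iff singular_def)

text \<open>The vector is singular: the string coefficient for e_i contains the factor a_i - a_i,
  and the other e_j commutes with f_i.\<close>

lemma chev_f_power_vac: "(act (chev_f i) ^^ Suc (a i)) vac = 0"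
proof (rule ccontr)
  let ?w = "(act (chev_f i) ^^ Suc (a i)) vac"
  assume nz: "?w \<noteq> 0"
  have v: "vac \<in> V (wt 0 0)" "act (chev_e j) vac = 0" for j
    using vac by (auto simp: singular_def wt_0)
  have "act (chev_e j) ?w = 0" for j
  proof (cases "j = i")
    case True
    have "act (cartan_embed (coroot i)) vac = smul (of_nat (a i)) vac"
      using weight_spaceD[OF v(1)] by (cases i) (simp_all add: pairing_wt)
    from sl2_string[of "act (chev_e i)" "act (chev_f i)" _ _ _ "a i", OF chev_sl2 this v(2)]
    show ?thesis using True by simp
  next
    case False
    then have "affine_bracket (chev_e j) (chev_f i) = 0"
      by (simp add: bracket_chev_ef)
    then have "act (chev_e j) ((act (chev_f i) ^^ k) vac) = 0" for k
      by (induction k) (simp_all add: v act_comm[of "chev_e j"])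
    then show ?thesis .
  qed
  then have "singular (wt 0 0 - of_nat (Suc (a i)) *s simple_root i) ?w"
    using funpow_chev_weight_space(2)[OF v(1)] by (simp add: singular_def del: funpow.simps of_nat_Suc)
  \<comment> \<open>The highest weight would have to lie in the cone below a strictly lower
    weight.\<close>
  from weights_subset_root_cone[OF this nz] hw_in_weights
  have "wt 0 0 \<in> root_cone (wt 0 0 - of_int (int (Suc (a i))) *s simple_root i)" by auto
  then show False
    unfolding wt_diff_root by (auto simp: root_cone_wt wt_eq_iff split: if_splits)
qed

lemma chev_f_nilpotent: "\<exists>N. (act (chev_f i) ^^ N) x = 0"
proof -
  have "nilpotent_on (chev_f i) vac"
    using chev_f_power_vac unfolding nilpotent_on_def by blast
  then have "nilpotent_on (chev_f i) x"
    by (rule nilpotent_on_span_words) (simp add: span_words_singular[OF vac])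
  then show ?thesis by (simp add: nilpotent_on_def)
qed

lemma chev_e_nilpotent:
  assumes "x \<in> V \<mu>"
  shows "\<exists>N. (act (chev_e i) ^^ N) x = 0"
proof (rule ccontr)
  assume *: "\<nexists>N. (act (chev_e i) ^^ N) x = 0"
  have **: "\<mu> + of_nat N *s simple_root i \<in> Wts" for N
  proof -
    have "(act (chev_e i) ^^ N) x \<noteq> 0" using * by blast
    with funpow_chev_weight_space(1)[OF assms, where i = i and k = N] show ?thesis
      by (auto simp: in_weights_iff)
  qed
  have "\<mu> \<in> Wts" using **[of 0] by simp
  then obtain m s where \<mu>: "\<mu> = wt m s" using weightsD by blast
  \<comment> \<open>Adding the simple root \<open>N\<close> times lowers s + m or s by
    \<open>N\<close>, which is large enough to make that coefficient negative.\<close>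
  define N where "N = nat (1 + \<bar>s\<bar> + \<bar>m\<bar>)"
  have "wt m s + of_int (int N) *s simple_root i \<in> Wts" using **[of N] by (simp add: \<mu>)
  then have "wt (m - int N) s \<in> Wts \<or> wt (m + int N) (s - int N) \<in> Wts"
    unfolding wt_add_root by (simp split: if_splits)
  then show False
  proof
    assume "wt (m - int N) s \<in> Wts"
    from wt_in_weightsD[OF this] show False unfolding N_def by linarith
  next
    assume "wt (m + int N) (s - int N) \<in> Wts"
    from wt_in_weightsD[OF this] show False unfolding N_def by linarith
  qed
qed

text \<open>In column coordinates the reflection in \<open>root1\<close> keeps the depth, while that
  in \<open>root0\<close> changes it because \<open>root0\<close> has a \<open>null_root\<close>
  component.\<close>

lemma weights_simple_reflection:
  "wt m s \<in> Wts \<Longrightarrow> wt (int (a True) - m) s \<in> Wts"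
  "wt m s \<in> Wts \<Longrightarrow> wt (- int (a False) - m) (s + int (a False) + 2 * m) \<in> Wts"
proof -
  assume \<mu>: "wt m s \<in> Wts"
  have "wt m s - of_int (if i then int (a True) - 2 * m else int (a False) + 2 * m) *s
      simple_root i \<in> Wts" for i
    by (rule weights_reflect[OF _ \<mu> pairing_wt(1)])
      (rule conjI chev_e_nilpotent chev_f_nilpotent | assumption)+
  from this[of True] this[of False]
  have "wt (m + (int (a True) - 2 * m)) s \<in> Wts"
    "wt (m - (int (a False) + 2 * m)) (s + (int (a False) + 2 * m)) \<in> Wts"
    unfolding wt_diff_root by simp_all
  moreover have "m + (int (a True) - 2 * m) = int (a True) - m"
    "m - (int (a False) + 2 * m) = - int (a False) - m"
    "s + (int (a False) + 2 * m) = s + int (a False) + 2 * m"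
    by simp_all
  ultimately show "wt (int (a True) - m) s \<in> Wts"
    "wt (- int (a False) - m) (s + int (a False) + 2 * m) \<in> Wts"
    by simp_all
qed

lemma weights_string:
  "k \<le> a True \<Longrightarrow> wt (int k) 0 \<in> Wts"
  "k \<le> a False \<Longrightarrow> wt (- int k) (int k) \<in> Wts"
proof -
  have "singular (wt 0 0) vac" by (simp add: wt_0 vac)
  then have *: "wt 0 0 - of_nat k *s simple_root i \<in> Wts" if "k \<le> a i" for i
    by (rule weights_chev_f_string[OF _ vac(2) _ that]) (cases i; simp add: pairing_wt)
  show "k \<le> a True \<Longrightarrow> wt (int k) 0 \<in> Wts"
    using *[of True] wt_diff_root[of 0 0 "int k" True] by simp
  show "k \<le> a False \<Longrightarrow> wt (- int k) (int k) \<in> Wts"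
    using *[of False] wt_diff_root[of 0 0 "int k" False] by simp
qed

text \<open>If \<open>H t\<inverse>\<close> killed a weight vector, the Heisenberg relation \<open>[H t, H t\<inverse>] = 2 K\<close>
  and the nonzero level would force all powers of \<open>H t\<close> to be nonzero on it.\<close>

lemma weights_diff_null_root:
  assumes level: "a False + a True > 0" and \<mu>: "wt m s \<in> Wts"
  shows "wt m (s + 1) \<in> Wts"
proof -
  obtain x where x: "x \<in> V (wt m s)" "x \<noteq> 0" using \<mu> by (auto simp: in_weights_iff)
  let ?r = "of_nat (a False + a True) :: complex"
  let ?X = "act (loop_H (tpow 1))" and ?Y = "act (loop_H (tpow (- 1)))"
  have "?Y x \<noteq> 0"
  proof
    assume Y: "?Y x = 0"
    have wx: "(?X ^^ n) x \<in> V (wt m (s - int n))" for n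
    proof (induction n)
      case (Suc n)
      from act_chev_weight_space(3)[OF this, of 1] show ?case
        using wt_add_root(2)[of m "s - int n" 1] by (simp add: algebra_simps)
    qed (simp add: x)
    have YX: "?Y (?X y) = ?X (?Y y) - smul (2 * ?r) y" if "y \<in> V (wt m s')" for y s'
      using weight_spaceD[OF that, of "central (- 2)"]
      by (simp add: act_comm[of "loop_H (tpow (- 1))"] bracket_HH pairing_wt flip: scale_minus_left)
    have Yn: "?Y ((?X ^^ Suc n) x) = smul (- 2 * ?r * of_nat (Suc n)) ((?X ^^ n) x)" for n
    proof (induction n)
      case 0
      then show ?case using YX[OF x(1)] by (simp add: Y flip: scale_minus_left)
    next
      case (Suc n)
      have "?Y ((?X ^^ Suc (Suc n)) x) = ?X (?Y ((?X ^^ Suc n) x)) - smul (2 * ?r) ((?X ^^ Suc n) x)"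
        using YX[OF wx[of "Suc n"]] by simp
      also have "\<dots> = smul (- 2 * ?r * of_nat (Suc n) - 2 * ?r) ((?X ^^ Suc n) x)"
        unfolding Suc.IH scale_left_diff_distrib by (simp add: act_scale_right)
      finally show ?case by (simp add: algebra_simps)
    qed
    have "(?X ^^ n) x \<noteq> 0" for n
    proof (induction n)
      case (Suc n)
      have "- 2 * ?r * of_nat (Suc n) \<noteq> 0" using level by (simp del: of_nat_Suc of_nat_add)
      then have "?Y ((?X ^^ Suc n) x) \<noteq> 0" unfolding Yn using Suc by simp
      then show ?case by (metis act_0 carrier_intros(3))
    qed (simp add: x)
    then have "wt m (s - int n) \<in> Wts" for n
      unfolding in_weights_iff using wx[of n] by (intro bexI[of _ "(?X ^^ n) x"]) auto
    \<comment> \<open>Raising s + 1 times by \<open>null_root\<close> would reach depth -1.\<close>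
    from wt_in_weightsD[OF this[of "nat (s + 1)"]] wt_in_weightsD[OF \<mu>] show False by simp
  qed
  moreover have "?Y x \<in> V (wt m (s + 1))"
    using act_chev_weight_space(3)[OF x(1), of "-1"] wt_add_root(2)[of m s "-1"] by simp
  ultimately show ?thesis by (auto simp: in_weights_iff)
qed

end

section \<open>Arithmetic of the column minima\<close>

definition max_weight_shift :: "nat \<Rightarrow> nat \<Rightarrow> int \<Rightarrow> int \<Rightarrow> int" where
  "max_weight_shift a0 a1 q u =
     max (- u) (max 0 (u - int a1)) - q * (int a1 - 2 * u) + q\<^sup>2 * (int a0 + int a1)"

text \<open>The module enters only through the predicate \<open>Q\<close>, and \<open>u\<close>
  stays fixed while \<open>q\<close> varies, so that the translation by a0 + a1 becomes an induction
  on \<open>q\<close> in both directions.\<close>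

lemma column_minimum:
  fixes Q :: "int \<Rightarrow> int \<Rightarrow> bool" and a0 a1 :: nat
  assumes nonneg: "\<And>m s. Q m s \<Longrightarrow> 0 \<le> s \<and> 0 \<le> s + m"
    and refl1: "\<And>m s. Q m s \<Longrightarrow> Q (int a1 - m) s"
    and refl0: "\<And>m s. Q m s \<Longrightarrow> Q (- int a0 - m) (s + int a0 + 2 * m)"
    and string1: "\<And>k. k \<le> a1 \<Longrightarrow> Q (int k) 0"
    and string0: "\<And>k. k \<le> a0 \<Longrightarrow> Q (- int k) (int k)"
    and up: "\<And>m s. Q m s \<Longrightarrow> Q m (s + 1)"
    and u: "- int a0 \<le> u" "u \<le> int a0 + int a1"
  shows "Q (q * (int a0 + int a1) + u) s \<longleftrightarrow> max_weight_shift a0 a1 q u \<le> s"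
proof -
  let ?r = "int a0 + int a1"
  have up: "Q m s'" if "s \<le> s'" "Q m s" for m s s'
    using that by (induction s' rule: int_ge_induct) (simp_all add: up)
  \<comment> \<open>The bound s + m >= 0 is attained by the string in direction
    \<open>root0\<close>; in \<open>pos\<close> the bound s >= 0 is attained by the string in
    direction \<open>root1\<close>.\<close>
  have neg: "Q u s \<longleftrightarrow> - u \<le> s" if "- int a0 \<le> u" "u \<le> 0" for u s
    using nonneg[of u s] string0[of "nat (- u)"] up[of "- u" s u] that by auto
  have pos: "Q u s \<longleftrightarrow> 0 \<le> s" if "0 \<le> u" "u \<le> int a1" for u s
    using nonneg[of u s] string1[of "nat u"] up[of 0 s u] that by auto
  have refl1_iff: "Q (int a1 - m) s \<longleftrightarrow> Q m s" for m s
    using refl1[of m s] refl1[of "int a1 - m" s] by auto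
  \<comment> \<open>The reflection carries this range to -a0 <= a1 - u <= 0, where
    \<open>neg\<close> applies.\<close>
  have big: "Q u s \<longleftrightarrow> u - int a1 \<le> s" if "int a1 \<le> u" "u \<le> ?r" for u s
    using refl1_iff[of u s] neg[of "int a1 - u" s] that by simp
  have base_case: "Q u s \<longleftrightarrow> max_weight_shift a0 a1 0 u \<le> s" for s
  proof -
    consider "u \<le> 0" | "0 \<le> u" "u \<le> int a1" | "int a1 \<le> u" by linarith
    then show ?thesis
      using neg[of u s] pos[of u s] big[of u s] u by cases (auto simp: max_weight_shift_def)
  qed
  have refl0_iff: "Q (- int a0 - m) (s + int a0 + 2 * m) \<longleftrightarrow> Q m s" for m s
    using refl0[of m s] refl0[of "- int a0 - m" "s + int a0 + 2 * m"] by (auto simp: algebra_simps)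
  \<comment> \<open>the composite of the two reflections\<close>
  have translate: "Q (m - ?r) (s + int a0 + 2 * int a1 - 2 * m) \<longleftrightarrow> Q m s" for m s
    using refl0_iff[of "int a1 - m" s] refl1_iff[of m s] by (simp add: algebra_simps)
  \<comment> \<open>The increment of the quadratic in \<open>q\<close> equals the change of depth
    under \<open>translate\<close> between the columns q r + u and (q + 1) r + u.\<close>
  have shift: "max_weight_shift a0 a1 (q + 1) u = max_weight_shift a0 a1 q u +
      2 * (q * ?r + u) + int a0" for q
    by (simp add: max_weight_shift_def algebra_simps power2_eq_square)
  show ?thesis
  proof (induction q arbitrary: s rule: int_induct[of _ 0])
    case base
    then show ?case using base_case by simp
  next
    case (step1 q)
    let ?m = "(q + 1) * ?r + u"
    have "Q ?m s \<longleftrightarrow> Q (q * ?r + u) (s + int a0 + 2 * int a1 - 2 * ?m)"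
      using translate[of ?m s] by (simp add: algebra_simps)
    also have "\<dots> \<longleftrightarrow> max_weight_shift a0 a1 (q + 1) u \<le> s"
      unfolding step1.IH shift by (simp add: algebra_simps)
    finally show ?case .
  next
    case (step2 q)
    let ?m = "q * ?r + u"
    have "Q ((q - 1) * ?r + u) s \<longleftrightarrow> Q ?m (s - int a0 - 2 * int a1 + 2 * ?m)"
      using translate[of ?m "s - int a0 - 2 * int a1 + 2 * ?m"] by (simp add: algebra_simps)
    also have "\<dots> \<longleftrightarrow> max_weight_shift a0 a1 (q - 1) u \<le> s"
      unfolding step2.IH using shift[of "q - 1"] by (simp add: algebra_simps)
    finally show ?case .
  qed
qed

section \<open>The maximal weights and their numerical invariants\<close>

theorem lemma4p1:
  fixes a0 a1 :: nat and r b0 :: int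
    and \<Lambda> :: weight and q u t :: "int \<Rightarrow> int" and \<eta> :: "int \<Rightarrow> weight"
    and smul :: "complex \<Rightarrow> 'v::ab_group_add \<Rightarrow> 'v" and act :: "affine \<Rightarrow> 'v \<Rightarrow> 'v"
    and P :: "weight set" and s :: "int \<Rightarrow> int"
  assumes \<Lambda>: "\<Lambda> = of_nat a0 *s Lambda0 + of_nat a1 *s Lambda1"
    and r: "r = int a0 + int a1" "r \<ge> 1"
    and b0: "b0 = \<lfloor>real a0 / 2\<rfloor>"
    and decomp: "\<And>m. m = q m * r + u m" "\<And>m. - b0 \<le> u m \<and> u m \<le> r - b0 - 1"
    and t: "\<And>m. t m = max (- u m) (max 0 (u m - int a1)) - q m * (int a1 - 2 * u m) + (q m)\<^sup>2 * r"
    and \<eta>: "\<And>m. \<eta> m = of_int (int a0 + 2 * m) *s Lambda0 + of_int (int a1 - 2 * m) *s Lambda1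
                      - of_int (t m) *s null_root"
    and V: "irreducible_module smul act" "highest_weight_module smul act \<Lambda>"
    and P: "P = weights smul act"
    and s: "s = max_shift P \<Lambda>"
  shows "(\<forall>m. hub (\<eta> m) = (of_int (int a0 + 2 * m), of_int (int a1 - 2 * m))) \<and>
    max_weights P = {\<eta> m | m. True} \<and>
    (\<forall>m. defect \<Lambda> (\<eta> m) =
       of_int (max (- u m * (int a0 + u m))
              (max (u m * (int a1 - u m)) ((u m - int a1) * (r - u m))))) \<and>
    (\<forall>m. content \<Lambda> (\<eta> m) = (s m, s m + m)) \<and>
    (\<forall>m. weight_degree \<Lambda> (\<eta> m) = 2 * s m + m)"
proof -
  have V': "affine_module smul act"
    "\<And>U. submodule smul act U \<Longrightarrow> U = {0} \<or> U = UNIV"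
    using V(1) by (auto simp: irreducible_module_def)
  obtain v where v: "v \<noteq> 0" "v \<in> weight_space smul act \<Lambda>" "\<forall>x\<in>n_plus. act x v = 0"
    using V(2) by (auto simp: highest_weight_module_def)
  interpret affine_module smul act by (rule V')
  have "singular \<Lambda> v"
    using v chev_e_n_plus by (auto simp: singular_def)
  then interpret irreducible_highest_weight smul act "\<lambda>i. if i then a1 else a0" \<Lambda> v
    by unfold_locales (simp_all add: \<Lambda> v V'(2))
  \<comment> \<open>These bounds place the window for \<open>u m\<close> inside the range from -a0
    to a0 + a1 covered by \<open>column_minimum\<close>.\<close>
  have "0 \<le> b0" "2 * b0 \<le> int a0"
    unfolding b0 by linarith+
  then have u: "- int a0 \<le> u m" "u m \<le> int a0 + int a1" for m
    using decomp(2)[of m] r by auto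
  have t_eq: "t m = max_weight_shift a0 a1 (q m) (u m)" for m
    using t[of m] r by (simp add: max_weight_shift_def)
  have column: "wt m s \<in> weights smul act \<longleftrightarrow> t m \<le> s" for m s
  proof -
    have "wt (q m * (int a0 + int a1) + u m) s \<in> weights smul act \<longleftrightarrow> t m \<le> s"
      unfolding t_eq
    proof (rule column_minimum[where Q = "\<lambda>m s. wt m s \<in> Wts"
          and ?a0.0 = a0 and ?a1.0 = a1 and u = "u m" and q = "q m" and s = s])
      show "wt m s \<in> Wts \<Longrightarrow> 0 \<le> s \<and> 0 \<le> s + m" for m s by (rule wt_in_weightsD)
      show "wt m s \<in> Wts \<Longrightarrow> wt (int a1 - m) s \<in> Wts" for m s
        using weights_simple_reflection(1)[of m s] by simp
      show "wt m s \<in> Wts \<Longrightarrow> wt (- int a0 - m) (s + int a0 + 2 * m) \<in> Wts" for m s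
        using weights_simple_reflection(2)[of m s] by simp
      show "k \<le> a1 \<Longrightarrow> wt (int k) 0 \<in> Wts" for k using weights_string(1)[of k] by simp
      show "k \<le> a0 \<Longrightarrow> wt (- int k) (int k) \<in> Wts" for k using weights_string(2)[of k] by simp
      have "a0 > 0 \<or> a1 > 0" using r by auto
      then show "wt m s \<in> Wts \<Longrightarrow> wt m (s + 1) \<in> Wts" for m s
        using weights_diff_null_root[of m s] by simp
      show "- int a0 \<le> u m" "u m \<le> int a0 + int a1" by (fact u)+
    qed
    also have "q m * (int a0 + int a1) + u m = m" using decomp(1)[of m] r by simp
    finally show ?thesis .
  qed
  have \<eta>_wt: "\<eta> m = wt m (t m)" for m
    unfolding \<eta> wt_def by (simp add: \<Lambda> root1_def vec_eq_iff algebra_simps)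
  \<comment> \<open>By \<open>column\<close>, each column of weights is the half-line of depths from
    \<open>t m\<close> on, so only its end loses weighthood when \<open>null_root\<close> is added.
    Uniqueness of this depth also evaluates \<open>max_shift\<close>.\<close>
  have max_iff: "wt m s \<in> max_weights P \<longleftrightarrow> s = t m" for m s
    using wt_add_root(2)[of m s 1] by (auto simp: max_weights_def P column)
  have max_eq: "max_weights P = {\<eta> m | m. True}"
  proof (intro subset_antisym subsetI)
    fix \<mu> assume \<mu>: "\<mu> \<in> max_weights P"
    then obtain m s where "\<mu> = wt m s" using weightsD[of \<mu>] by (auto simp: max_weights_def P)
    with \<mu> show "\<mu> \<in> {\<eta> m | m. True}" by (auto simp: max_iff \<eta>_wt)
  qed (auto simp: max_iff \<eta>_wt)
  have hub: "hub (\<eta> m) = (of_int (int a0 + 2 * m), of_int (int a1 - 2 * m))" for m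
    using pairing_wt(1)[of m "t m" False] pairing_wt(1)[of m "t m" True]
    by (simp add: hub_def \<eta>_wt coroot_def)
  have s_eq: "s m = t m" for m
    unfolding s max_shift_def wt_def[symmetric] max_iff by simp
  have content: "content \<Lambda> (\<eta> m) = (t m, t m + m)" for m
  proof -
    have *: "\<Lambda> - (of_int c0 *s root0 + of_int c1 *s root1) = wt (c1 - c0) c0" for c0 c1
      by (simp add: wt_def root_eq vec_eq_iff algebra_simps)
    have "0 \<le> t m \<and> 0 \<le> t m + m" using column[of m "t m"] wt_in_weightsD by blast
    then show ?thesis
      unfolding content_def * \<eta>_wt wt_eq_iff by (intro the_equality) auto
  qed
  have defect: "defect \<Lambda> (\<eta> m) =
       of_int (max (- u m * (int a0 + u m))
              (max (u m * (int a1 - u m)) ((u m - int a1) * (r - u m))))" for m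
  proof -
    let ?M = "max (- u m) (max 0 (u m - int a1))"
    \<comment> \<open>Multiplication by the positive \<open>r\<close> commutes with the
      maximum.\<close>
    have rM: "r * ?M = max (r * - u m) (max 0 (r * (u m - int a1)))"
      using r(2) by (simp add: max_mult_distrib_left del: mult_minus_right)
    \<comment> \<open>All terms in \<open>q m\<close> cancel, reflecting the invariance of the form
      under translations in the Weyl group: the defect depends on \<open>u m\<close> only.\<close>
    have shift: "r * t m + m * int a1 - m\<^sup>2 = r * ?M + u m * (int a1 - u m)"
    proof -
      have "r * (k - x * (int a1 - 2 * y) + x\<^sup>2 * r) + (x * r + y) * int a1 - (x * r + y)\<^sup>2 =
          r * k + y * (int a1 - y)" for k x y
        by (simp add: algebra_simps power2_eq_square)
      from this[of ?M "q m" "u m"] show ?thesis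
        unfolding t[of m] decomp(1)[of m, symmetric] .
    qed
    have \<Lambda>_nth: "\<Lambda> $ 1 = of_nat a0" "\<Lambda> $ 2 = of_nat a1" "\<Lambda> $ 3 = 0"
      by (simp_all add: \<Lambda> Lambda0_def Lambda1_def axis_def)
    have \<eta>_nth: "\<eta> m $ 1 = of_nat a0 + 2 * of_int m" "\<eta> m $ 2 = of_nat a1 - 2 * of_int m"
      "\<eta> m $ 3 = - of_int (t m)"
      by (simp_all add: \<eta> Lambda0_def Lambda1_def null_root_def axis_def)
    have "defect \<Lambda> (\<eta> m) =
        (of_nat a0 + of_nat a1) * of_int (t m) + of_int m * of_nat a1 - (of_int m)\<^sup>2"
      unfolding defect_def form_def \<Lambda>_nth \<eta>_nth by (simp add: field_simps power2_eq_square)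
    then have "defect \<Lambda> (\<eta> m) = of_int (r * t m + m * int a1 - m\<^sup>2)"
      by (simp add: r(1))
    \<comment> \<open>Adding u (a1 - u) to -r u, 0 and r (u - a1) gives the three claimed
      expressions term by term.\<close>
    moreover have "r * t m + m * int a1 - m\<^sup>2 = max (- u m * (int a0 + u m))
        (max (u m * (int a1 - u m)) ((u m - int a1) * (r - u m)))"
      unfolding shift rM max_add_distrib_left by (simp add: r(1) algebra_simps)
    ultimately show ?thesis by (simp only:)
  qed
  show ?thesis
    using hub max_eq defect content s_eq by (simp add: weight_degree_def)
qed

end
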